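(* Let $0<\alpha\le 1$, let $n$ be a natural number, and let $L_n(\tfrac{x^\alpha}{\alpha})$ be the conformable Laguerre polynomial. Then for all $x>0$, $$L_n\!\left(\frac{x^\alpha}{\alpha}\right)=\frac{e^{\frac{x^\alpha}{\alpha}}}{\alpha^n\, n!}\,D^{n\alpha}\!\left[x^{n\alpha}e^{-\frac{x^\alpha}{\alpha}}\right].$$
   Context: For $0<\alpha\le 1$, the conformable derivative of order $\alpha$ of a function $f$ at $x>0$ is $D^\alpha f(x)=\lim_{\epsilon\to 0}\frac{f(x+\epsilon x^{1-\alpha})-f(x)}{\epsilon}$. $D^{n\alpha}$ denotes the $n$-fold composition $D^\alpha\circ\cdots\circ D^\alpha$ (with $D^{0}$ the identity), acting in the variable $x$. The conformable Laguerre polynomial of order $n$ is $$L_n\!\left(\frac{x^\alpha}{\alpha}\right)=\sum_{k=0}^n (-1)^k \frac{n!}{\alpha^k\,(n-k)!\,(k!)^2}\,x^{k\alpha}.$$ *)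

theory Defs
  imports Complex_Main
begin

definition has_conformable_derivative :: "real \<Rightarrow> (real \<Rightarrow> real) \<Rightarrow> real \<Rightarrow> real \<Rightarrow> bool" where
  "has_conformable_derivative \<alpha> f d x \<longleftrightarrow>
     ((\<lambda>\<epsilon>. (f (x + \<epsilon> * x powr (1 - \<alpha>)) - f x) / \<epsilon>) \<longlongrightarrow> d) (at 0)"

text \<open>Meaningful for \<open>x > 0\<close> only, and only where the limit exists;
  elsewhere the value is unspecified.\<close>

definition conformable_deriv :: "real \<Rightarrow> (real \<Rightarrow> real) \<Rightarrow> real \<Rightarrow> real" where
  "conformable_deriv \<alpha> f x =
     Lim (at 0) (\<lambda>\<epsilon>. (f (x + \<epsilon> * x powr (1 - \<alpha>)) - f x) / \<epsilon>)"

text \<open>As a function of \<open>x\<close>; the informal notation is \<open>L\<^sub>n(x\<^sup>\<alpha> / \<alpha>)\<close>.\<close>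

definition conformable_laguerre :: "real \<Rightarrow> nat \<Rightarrow> real \<Rightarrow> real" where
  "conformable_laguerre \<alpha> n x =
     (\<Sum>k=0..n. (- 1) ^ k * (fact n / (\<alpha> ^ k * fact (n - k) * (fact k)\<^sup>2)) * x powr (real k * \<alpha>))"

end

theory Submission
  imports Defs
begin

text \<open>
  The substitution \<open>u = x\<^sup>\<alpha> / \<alpha>\<close> turns the conformable derivative into the ordinary one, because
  \<open>du/dx = x\<^bsup>\<alpha> - 1\<^esup>\<close> cancels the factor \<open>x\<^bsup>1 - \<alpha>\<^esup>\<close>.  Since \<open>x\<^bsup>n\<alpha>\<^esup> = \<alpha>\<^sup>n u\<^sup>n\<close>, the claim becomes
  the classical Rodrigues formula, which follows by expanding the \<open>n\<close>-th derivative of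
  \<open>u\<^sup>n e\<^bsup>-u\<^esup>\<close> with the Leibniz rule.
\<close>

text \<open>Chain rule for the line \<open>x + \<epsilon> * x powr (1 - \<alpha>)\<close> at
  \<open>\<epsilon> = 0\<close>, whose slope is \<open>x powr (1 - \<alpha>)\<close>.\<close>

lemma has_conformable_derivative_of_real_derivative:
  assumes "(f has_real_derivative d) (at x)"
  shows "has_conformable_derivative \<alpha> f (x powr (1 - \<alpha>) * d) x"
proof -
  have "((\<lambda>\<epsilon>. f (x + \<epsilon> * x powr (1 - \<alpha>))) has_real_derivative d * x powr (1 - \<alpha>)) (at 0)"
    by (rule DERIV_chain2[where f = f]) (use assms in \<open>auto intro!: derivative_eq_intros\<close>)
  then show ?thesis
    by (simp add: has_conformable_derivative_def DERIV_def mult.commute)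
qed

lemma conformable_deriv_eq:
  "has_conformable_derivative \<alpha> f d x \<Longrightarrow> conformable_deriv \<alpha> f x = d"
  unfolding has_conformable_derivative_def conformable_deriv_def
  by (rule tendsto_Lim) simp_all

lemma has_conformable_derivative_substitution:
  fixes f g :: "real \<Rightarrow> real"
  assumes "0 < \<alpha>" and "0 < x"
    and f: "\<And>t. 0 < t \<Longrightarrow> f t = g (t powr \<alpha> / \<alpha>)"
    and g: "(g has_real_derivative d) (at (x powr \<alpha> / \<alpha>))"
  shows "has_conformable_derivative \<alpha> f d x"
proof -
  have "((\<lambda>t. t powr \<alpha> / \<alpha>) has_real_derivative x powr (\<alpha> - 1)) (at x)"
    using assms(1,2) by (auto intro!: derivative_eq_intros simp: powr_diff)
  with g have "((\<lambda>t. g (t powr \<alpha> / \<alpha>)) has_real_derivative d * x powr (\<alpha> - 1)) (at x)"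
    by (rule DERIV_chain2)
  \<comment> \<open>Differentiability is local, so agreement on the open half-line around
    \<open>x\<close> is enough.\<close>
  then have "(f has_real_derivative d * x powr (\<alpha> - 1)) (at x)"
    by (rule has_field_derivative_transform_within_open[where S = "{0<..}"])
      (use assms in auto)
  from has_conformable_derivative_of_real_derivative[OF this, of \<alpha>]
  show ?thesis
    using assms(2) by (simp add: mult.left_commute flip: powr_add)
qed

text \<open>Each induction step needs the previous iterate on the whole half-line, not just at one
  point, hence the induction over arbitrary \<open>x\<close>.\<close>

lemma conformable_deriv_funpow_substitution:
  fixes f :: "real \<Rightarrow> real" and F :: "nat \<Rightarrow> real \<Rightarrow> real"
  assumes "0 < \<alpha>" and "0 < x"
    and f: "\<And>t. 0 < t \<Longrightarrow> f t = F 0 (t powr \<alpha> / \<alpha>)"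
    and F: "\<And>k u. (F k has_real_derivative F (Suc k) u) (at u)"
  shows "(conformable_deriv \<alpha> ^^ k) f x = F k (x powr \<alpha> / \<alpha>)"
  using \<open>0 < x\<close>
proof (induction k arbitrary: x)
  case 0
  then show ?case by (simp add: f)
next
  case (Suc k)
  then show ?case
    by (auto intro!: conformable_deriv_eq
        has_conformable_derivative_substitution[where g = "F k"] assms(1) F)
qed

text \<open>When \<open>f j\<close> and \<open>g j\<close> are the \<open>j\<close>-th derivatives
  of \<open>f 0\<close> and \<open>g 0\<close>, this is the \<open>k\<close>-th derivative of their
  product. Passing explicit sequences avoids iterating a derivative operator.\<close>

definition leibniz_sum :: "(nat \<Rightarrow> real \<Rightarrow> real) \<Rightarrow> (nat \<Rightarrow> real \<Rightarrow> real) \<Rightarrow> nat \<Rightarrow> real \<Rightarrow> real" where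
  "leibniz_sum f g k u = (\<Sum>j\<le>k. real (k choose j) * f j u * g (k - j) u)"

text \<open>Pascal's rule. The right-hand side is what the product rule yields when
  \<open>leibniz_sum f g k\<close> is differentiated termwise.\<close>

lemma leibniz_sum_Suc:
  "leibniz_sum f g (Suc k) u =
    (\<Sum>j\<le>k. real (k choose j) * (f (Suc j) u * g (k - j) u + f j u * g (Suc (k - j)) u))"
proof -
  have "leibniz_sum f g (Suc k) u = f 0 u * g (Suc k) u +
      (\<Sum>j\<le>k. real (k choose j) * f (Suc j) u * g (k - j) u) +
      (\<Sum>j\<le>k. real (k choose Suc j) * f (Suc j) u * g (k - j) u)"
    unfolding leibniz_sum_def
    by (subst sum.atMost_Suc_shift) (simp add: algebra_simps sum.distrib)
  also have "f 0 u * g (Suc k) u + (\<Sum>j\<le>k. real (k choose Suc j) * f (Suc j) u * g (k - j) u) =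
      (\<Sum>j\<le>Suc k. real (k choose j) * f j u * g (Suc k - j) u)"
    by (subst sum.atMost_Suc_shift) simp
  \<comment> \<open>The summand at \<open>j = Suc k\<close> drops out because
    \<open>k choose Suc k\<close> is 0.\<close>
  then have "f 0 u * g (Suc k) u +
      (\<Sum>j\<le>k. real (k choose j) * f (Suc j) u * g (k - j) u) +
      (\<Sum>j\<le>k. real (k choose Suc j) * f (Suc j) u * g (k - j) u) =
      (\<Sum>j\<le>k. real (k choose j) * f (Suc j) u * g (k - j) u) +
      (\<Sum>j\<le>k. real (k choose j) * f j u * g (Suc k - j) u)"
    by (simp add: binomial_eq_0)
  also have "\<dots> =
      (\<Sum>j\<le>k. real (k choose j) * (f (Suc j) u * g (k - j) u + f j u * g (Suc (k - j)) u))"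
    by (simp add: sum.distrib[symmetric] Suc_diff_le algebra_simps)
  finally show ?thesis .
qed

lemma has_real_derivative_leibniz_sum:
  assumes "\<And>k u. (f k has_real_derivative f (Suc k) u) (at u)"
    and "\<And>k u. (g k has_real_derivative g (Suc k) u) (at u)"
  shows "(leibniz_sum f g k has_real_derivative leibniz_sum f g (Suc k) u) (at u)"
  unfolding leibniz_sum_Suc unfolding leibniz_sum_def[abs_def]
  by (auto intro!: derivative_eq_intros assms sum.cong simp: algebra_simps)

text \<open>The derivatives of \<open>u ^ n\<close>. The case split is essential: for
  \<open>j > n\<close> truncated subtraction would give the constant \<open>fact n\<close> instead
  of 0.\<close>

definition power_derivs :: "nat \<Rightarrow> nat \<Rightarrow> real \<Rightarrow> real" where
  "power_derivs n j u = (if j \<le> n then fact n / fact (n - j) * u ^ (n - j) else 0)"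

lemma has_real_derivative_power_derivs:
  "(power_derivs n j has_real_derivative power_derivs n (Suc j) u) (at u)"
proof (cases "j < n")
  case True
  then obtain m where m: "n - j = Suc m" "n - Suc j = m"
    by (metis Suc_diff_Suc)
  have "((\<lambda>u. fact n / fact (Suc m) * u ^ Suc m) has_real_derivative
      fact n / fact (Suc m) * (real (Suc m) * u ^ m)) (at u)"
    using DERIV_pow[of "Suc m" u UNIV] by (intro DERIV_cmult) simp
  moreover have "fact n / fact (Suc m) * (real (Suc m) * u ^ m) = fact n / fact m * u ^ m"
    by (simp only: fact_Suc of_nat_mult) simp
  ultimately show ?thesis
    using True unfolding power_derivs_def[abs_def] m by (simp del: fact_Suc power_Suc)
next
  case False
  \<comment> \<open>From order \<open>n\<close> on, every derivative is constant:
    \<open>fact n\<close> at \<open>j = n\<close>, then 0.\<close>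
  then have "power_derivs n j = (\<lambda>u. if j = n then fact n else 0)"
    and "power_derivs n (Suc j) u = 0"
    by (auto simp: power_derivs_def fun_eq_iff)
  then show ?thesis by simp
qed

lemma has_real_derivative_exp_uminus_derivs:
  "((\<lambda>u. (- 1) ^ k * exp (- u)) has_real_derivative (- 1) ^ Suc k * exp (- u)) (at u)" for u :: real
  by (auto intro!: derivative_eq_intros)

text \<open>Reversing the sum makes \<open>k\<close> count the derivatives falling on the
  exponential. The remaining factor is \<open>fact n / fact k * u ^ k\<close>, and multiplying it by
  \<open>n choose (n - k)\<close> gives \<open>fact n\<close> times the Laguerre
  coefficient.\<close>

lemma laguerre_rodrigues_leibniz:
  "leibniz_sum (power_derivs n) (\<lambda>k u. (- 1) ^ k * exp (- u)) n u =
    fact n * exp (- u) * (\<Sum>k=0..n. (- 1) ^ k * (fact n / (fact (n - k) * (fact k)\<^sup>2)) * u ^ k)"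
proof -
  have "leibniz_sum (power_derivs n) (\<lambda>k u. (- 1) ^ k * exp (- u)) n u =
      (\<Sum>k=0..n. real (n choose (n - k)) * power_derivs n (n - k) u * ((- 1) ^ k * exp (- u)))"
    unfolding leibniz_sum_def atMost_atLeast0
    by (subst sum.atLeastAtMost_rev) (auto intro!: sum.cong)
  also have "\<dots> = (\<Sum>k=0..n. fact n * exp (- u) *
      ((- 1) ^ k * (fact n / (fact (n - k) * (fact k)\<^sup>2)) * u ^ k))"
    by (rule sum.cong)
      (auto simp: power_derivs_def binomial_fact power2_eq_square field_simps)
  finally show ?thesis by (simp add: sum_distrib_left)
qed

theorem mainTheorem2:
  fixes \<alpha> x :: real and n :: nat
  assumes "0 < \<alpha>" and "\<alpha> \<le> 1" and "0 < x"
  shows "(\<forall>k<n. \<exists>d. has_conformable_derivative \<alpha>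
            ((conformable_deriv \<alpha> ^^ k) (\<lambda>t. t powr (real n * \<alpha>) * exp (- (t powr \<alpha> / \<alpha>)))) d x) \<and>
         conformable_laguerre \<alpha> n x =
           exp (x powr \<alpha> / \<alpha>) / (\<alpha> ^ n * fact n) *
           (conformable_deriv \<alpha> ^^ n) (\<lambda>t. t powr (real n * \<alpha>) * exp (- (t powr \<alpha> / \<alpha>))) x"
proof -
  define f where "f = (\<lambda>t. t powr (real n * \<alpha>) * exp (- (t powr \<alpha> / \<alpha>)))"
  define G where "G = leibniz_sum (power_derivs n) (\<lambda>k u. (- 1) ^ k * exp (- u))"
  define F where "F = (\<lambda>k u. \<alpha> ^ n * G k u)"
  have powr_nat: "t powr (real k * \<alpha>) = \<alpha> ^ k * (t powr \<alpha> / \<alpha>) ^ k" if "0 < t" for t k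
    using that \<open>0 < \<alpha>\<close>
    by (simp add: power_divide mult.commute flip: powr_powr powr_realpow)
  have F: "(F k has_real_derivative F (Suc k) u) (at u)" for k u
    unfolding F_def G_def
    by (intro DERIV_cmult has_real_derivative_leibniz_sum has_real_derivative_power_derivs
        has_real_derivative_exp_uminus_derivs)
  have f: "f t = F 0 (t powr \<alpha> / \<alpha>)" if "0 < t" for t
    using powr_nat[OF that, of n]
    by (simp add: f_def F_def G_def leibniz_sum_def power_derivs_def)
  have iter: "(conformable_deriv \<alpha> ^^ k) f t = F k (t powr \<alpha> / \<alpha>)" if "0 < t" for t k
    using \<open>0 < \<alpha>\<close> that f F by (rule conformable_deriv_funpow_substitution)
  \<comment> \<open>This shows that the limits behind the iterates really exist, so that no
    unspecified value of \<open>Lim\<close> enters.\<close>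
  have "has_conformable_derivative \<alpha> ((conformable_deriv \<alpha> ^^ k) f) (F (Suc k) (x powr \<alpha> / \<alpha>)) x"
    for k
    using assms(1,3) iter F by (rule has_conformable_derivative_substitution)
  moreover have "conformable_laguerre \<alpha> n x =
      exp (x powr \<alpha> / \<alpha>) / (\<alpha> ^ n * fact n) * (conformable_deriv \<alpha> ^^ n) f x"
  proof -
    \<comment> \<open>In the variable \<open>x powr \<alpha> / \<alpha>\<close> the powers of
      \<open>\<alpha>\<close> in the denominators are absorbed.\<close>
    have "conformable_laguerre \<alpha> n x = (\<Sum>k=0..n.
        (- 1) ^ k * (fact n / (fact (n - k) * (fact k)\<^sup>2)) * (x powr \<alpha> / \<alpha>) ^ k)"
      unfolding conformable_laguerre_def
      by (rule sum.cong) (use assms in \<open>auto simp: powr_nat\<close>)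
    also have "\<dots> = exp (x powr \<alpha> / \<alpha>) / (\<alpha> ^ n * fact n) * F n (x powr \<alpha> / \<alpha>)"
      using \<open>0 < \<alpha>\<close> unfolding F_def G_def laguerre_rodrigues_leibniz
      by (simp add: exp_minus)
    finally show ?thesis by (simp add: iter \<open>0 < x\<close>)
  qed
  ultimately show ?thesis unfolding f_def by blast
qed

end
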